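(* Let $L_1$ and $L_2$ be finite dimensional non-solvable Lie superalgebras. If $L_1$ and $L_2$ are isomorphic as Lie superalgebras, then: (1) the solvable graphs $\mathfrak{S}(L_1)$ and $\mathfrak{S}(L_2)$ are isomorphic as graphs; (2) the non-solvable graphs $\mathfrak{S}(L_1)^{c}$ and $\mathfrak{S}(L_2)^{c}$ are isomorphic as graphs.
   Context: All Lie superalgebras are over a fixed field $\mathbb{F}$ with $\operatorname{char}\mathbb{F}\neq 2$ (if $\operatorname{char}\mathbb{F}=3$, the axioms also include $[x,[x,x]]=0$ for all odd $x$). "Subalgebra" means subsuperalgebra ($\mathbb{Z}_2$-graded subspace closed under the bracket), and $\langle x,y\rangle$ denotes the subalgebra (subsuperalgebra) generated by the (not necessarily homogeneous) elements $x,y$. Solvable means that the derived series reaches $0$. $\operatorname{sol}(L)=\{x\in L\mid\langle z,x\rangle\text{ is solvable for all }z\in L\}$. For a finite dimensional non-solvable Lie superalgebra $L$, the solvable graph $\mathfrak{S}(L)=(V,E)$ is the simple graph with vertex set $V=L\setminus(\operatorname{sol}(L)\cup\{0\})$ in which distinct $x,y\in V$ are adjacent if and only if $\langle x,y\rangle$ is solvable. The non-solvable graph $\mathfrak{S}(L)^{c}$ has the same vertex set, and distinct $x,y\in V$ are adjacent if and only if $\langle x,y\rangle$ is non-solvable. *)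

theory Defs
  imports "HOL-Library.Z2" "Graph_Theory.Graph_Theory"
begin

text \<open>
  The underlying space of a Lie superalgebra is the whole type \<^typ>\<open>'a\<close>, and
  \<^term>\<open>gr 0\<close> and \<^term>\<open>gr 1\<close> are its even and odd parts. Degrees are of type
  \<^typ>\<open>bit\<close>, the integers mod 2, so \<^term>\<open>i + j\<close> in \<open>bracket_degree\<close> is addition mod 2.
\<close>

definition parity_sign :: "bit \<Rightarrow> bit \<Rightarrow> 'k::field" where
  "parity_sign i j = (if i = 1 \<and> j = 1 then - 1 else 1)"

locale lie_superalgebra = vector_space scale
  for scale :: "'k::field \<Rightarrow> 'a::ab_group_add \<Rightarrow> 'a" (infixr \<open>*s\<close> 75) +
  fixes bracket :: "'a \<Rightarrow> 'a \<Rightarrow> 'a"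
    and gr :: "bit \<Rightarrow> 'a set"
  assumes char_not_2: "CHAR('k) \<noteq> 2"
    and subspace_gr: "subspace (gr i)"
    and gr_inter: "gr 0 \<inter> gr 1 = {0}"
    and gr_sum: "\<exists>a \<in> gr 0. \<exists>b \<in> gr 1. x = a + b"
    and bracket_linear_left: "Vector_Spaces.linear scale scale (\<lambda>x. bracket x y)"
    and bracket_linear_right: "Vector_Spaces.linear scale scale (bracket x)"
    and bracket_degree: "x \<in> gr i \<Longrightarrow> y \<in> gr j \<Longrightarrow> bracket x y \<in> gr (i + j)"
    and bracket_skew: "x \<in> gr i \<Longrightarrow> y \<in> gr j \<Longrightarrow>
      bracket x y = - (parity_sign i j *s bracket y x)"
    and bracket_jacobi: "x \<in> gr i \<Longrightarrow> y \<in> gr j \<Longrightarrow> z \<in> gr k \<Longrightarrow>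
      bracket x (bracket y z) =
        bracket (bracket x y) z + parity_sign i j *s bracket y (bracket x z)"
    and bracket_cube: "CHAR('k) = 3 \<Longrightarrow> x \<in> gr 1 \<Longrightarrow> bracket x (bracket x x) = 0"
begin

definition subsuperalgebra :: "'a set \<Rightarrow> bool" where
  "subsuperalgebra S \<longleftrightarrow>
     subspace S \<and>
     (\<forall>x \<in> S. \<exists>a \<in> S \<inter> gr 0. \<exists>b \<in> S \<inter> gr 1. x = a + b) \<and>
     (\<forall>x \<in> S. \<forall>y \<in> S. bracket x y \<in> S)"

definition generated :: "'a \<Rightarrow> 'a \<Rightarrow> 'a set" where
  "generated x y = subsuperalgebra hull {x, y}"

primrec derived_series :: "'a set \<Rightarrow> nat \<Rightarrow> 'a set" where
  "derived_series S 0 = S"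
| "derived_series S (Suc n) =
     span {bracket x y | x y. x \<in> derived_series S n \<and> y \<in> derived_series S n}"

definition solvable :: "'a set \<Rightarrow> bool" where
  "solvable S \<longleftrightarrow> (\<exists>n. derived_series S n = {0})"

definition sol :: "'a set" where
  "sol = {x. \<forall>z. solvable (generated z x)}"

definition graph_vertices :: "'a set" where
  "graph_vertices = UNIV - (sol \<union> {0})"

text \<open>
  A simple graph, with possibly infinitely many vertices, is a symmetric loop-free digraph
  without parallel arcs; the edge between x and y is the pair of arcs (x, y) and (y, x).
\<close>

definition solvable_graph :: "'a pair_pre_digraph" where
  "solvable_graph =
     \<lparr> pverts = graph_vertices,
       parcs = {(x, y). x \<in> graph_vertices \<and> y \<in> graph_vertices \<and> x \<noteq> y \<and>
                        solvable (generated x y)} \<rparr>"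

definition nonsolvable_graph :: "'a pair_pre_digraph" where
  "nonsolvable_graph =
     \<lparr> pverts = graph_vertices,
       parcs = {(x, y). x \<in> graph_vertices \<and> y \<in> graph_vertices \<and> x \<noteq> y \<and>
                        \<not> solvable (generated x y)} \<rparr>"

lemma gr_decomp_unique:
  assumes "a \<in> gr 0" "a' \<in> gr 0" "b \<in> gr 1" "b' \<in> gr 1" "a + b = a' + b'"
  shows "a = a'" "b = b'"
proof -
  have eq: "a - a' = b' - b"
    using assms(5) by (simp add: algebra_simps)
  have "a - a' \<in> gr 0"
    using assms(1,2) by (rule subspace_diff[OF subspace_gr])
  moreover have "b' - b \<in> gr 1"
    using assms(4,3) by (rule subspace_diff[OF subspace_gr])
  ultimately have "a - a' \<in> gr 0 \<inter> gr 1"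
    unfolding eq by (rule IntI)
  then have "a - a' = 0"
    unfolding gr_inter by (rule singletonD)
  then show "a = a'" "b = b'"
    using eq by simp_all
qed

lemma subsuperalgebra_generated: "subsuperalgebra (generated x y)"
  unfolding generated_def
proof (rule hull_in)
  fix T assume T: "Ball T subsuperalgebra"
  have dec: "\<exists>a \<in> \<Inter>T \<inter> gr 0. \<exists>b \<in> \<Inter>T \<inter> gr 1. z = a + b" if z: "z \<in> \<Inter>T" for z
  proof -
    obtain a b where ab: "a \<in> gr 0" "b \<in> gr 1" "z = a + b"
      using gr_sum by blast
    have "a \<in> S \<and> b \<in> S" if S: "S \<in> T" for S
    proof -
      obtain a' b' where *: "a' \<in> S \<inter> gr 0" "b' \<in> S \<inter> gr 1" "z = a' + b'"
        using bspec[OF T S] InterD[OF z S] unfolding subsuperalgebra_def by metis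
      then show ?thesis
        using gr_decomp_unique[of a a' b b'] ab by auto
    qed
    with ab show ?thesis by blast
  qed
  have "subspace (\<Inter>T)"
    by (rule subspace_Inter) (use T in \<open>simp add: subsuperalgebra_def\<close>)
  moreover have "\<forall>x \<in> \<Inter>T. \<forall>y \<in> \<Inter>T. bracket x y \<in> \<Inter>T"
    using T unfolding subsuperalgebra_def by blast
  ultimately show "subsuperalgebra (\<Inter>T)"
    using dec by (simp only: subsuperalgebra_def ball_simps) simp
qed

lemma generated_commute: "generated x y = generated y x"
  by (simp add: generated_def insert_commute)

lemma simple_solvable_graph: "pair_bidirected_digraph solvable_graph"
  by unfold_locales
    (auto simp: solvable_graph_def symmetric_def sym_def generated_commute)

lemma simple_nonsolvable_graph: "pair_bidirected_digraph nonsolvable_graph"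
  by unfold_locales
    (auto simp: nonsolvable_graph_def symmetric_def sym_def generated_commute)

end

definition lie_superalgebra_isomorphic ::
    "('k::field \<Rightarrow> 'a::ab_group_add \<Rightarrow> 'a) \<Rightarrow> ('a \<Rightarrow> 'a \<Rightarrow> 'a) \<Rightarrow> (bit \<Rightarrow> 'a set) \<Rightarrow>
     ('k \<Rightarrow> 'b::ab_group_add \<Rightarrow> 'b) \<Rightarrow> ('b \<Rightarrow> 'b \<Rightarrow> 'b) \<Rightarrow> (bit \<Rightarrow> 'b set) \<Rightarrow> bool" where
  "lie_superalgebra_isomorphic s1 br1 gr1 s2 br2 gr2 \<longleftrightarrow>
     (\<exists>f. Vector_Spaces.linear s1 s2 f \<and> bij f \<and>
          (\<forall>i. f ` gr1 i \<subseteq> gr2 i) \<and>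
          (\<forall>x y. f (br1 x y) = br2 (f x) (f y)))"

text \<open>On digraphs whose arcs are pairs, \<^const>\<open>digraph_iso\<close> is the usual isomorphism of graphs.\<close>

lemma digraph_iso_pair_iff:
  assumes "pair_wf_digraph G" "pair_wf_digraph H"
  shows "digraph_iso (with_proj G) (with_proj H) \<longleftrightarrow>
    (\<exists>f. bij_betw f (pverts G) (pverts H) \<and>
         (\<forall>x \<in> pverts G. \<forall>y \<in> pverts G. (x, y) \<in> parcs G \<longleftrightarrow> (f x, f y) \<in> parcs H))"
    (is "?L \<longleftrightarrow> ?R")
proof
  interpret G: pair_wf_digraph G by fact
  interpret H: pair_wf_digraph H by fact
  {
    assume ?L
    then obtain h where h: "pre_digraph.digraph_isomorphism (with_proj G) h"
      and H: "with_proj H = app_iso h (with_proj G)"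
      unfolding digraph_iso_def by blast
    have V: "pverts H = iso_verts h ` pverts G" and A: "parcs H = iso_arcs h ` parcs G"
      and t: "iso_tail h = fst" and hd: "iso_head h = snd"
      using arg_cong[OF H, of verts] arg_cong[OF H, of arcs]
        arg_cong[OF H, of tail] arg_cong[OF H, of head] by simp_all
    have inj: "inj_on (iso_verts h) (pverts G)"
      and ends: "\<And>a. a \<in> parcs G \<Longrightarrow>
        iso_arcs h a = (iso_verts h (fst a), iso_verts h (snd a))"
      using h t hd by (auto simp: pre_digraph.digraph_isomorphism_def intro!: prod_eqI)
    have "(x, y) \<in> parcs G \<longleftrightarrow> (iso_verts h x, iso_verts h y) \<in> parcs H"
      if xy: "x \<in> pverts G" "y \<in> pverts G" for x y
    proof
      show "(iso_verts h x, iso_verts h y) \<in> parcs H" if "(x, y) \<in> parcs G"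
        using that ends[OF that] A by (metis fst_conv image_eqI snd_conv)
    next
      assume "(iso_verts h x, iso_verts h y) \<in> parcs H"
      then obtain u v where uv: "(u, v) \<in> parcs G"
        "iso_verts h x = iso_verts h u" "iso_verts h y = iso_verts h v"
        using A ends by auto
      then have "x = u" "y = v"
        using inj xy G.wellformed'[OF uv(1)] by (auto dest: inj_onD)
      with uv show "(x, y) \<in> parcs G" by simp
    qed
    with inj V show ?R unfolding bij_betw_def by blast
  }
  {
    assume ?R
    then obtain f where f: "bij_betw f (pverts G) (pverts H)"
      and adj: "\<And>x y. x \<in> pverts G \<Longrightarrow> y \<in> pverts G \<Longrightarrow>
        (x, y) \<in> parcs G \<longleftrightarrow> (f x, f y) \<in> parcs H"
      by blast
    define h where "h = \<lparr> iso_verts = f, iso_arcs = map_prod f f,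
      iso_head = snd, iso_tail = fst \<rparr>"
    have inj: "inj_on f (pverts G)" and V: "f ` pverts G = pverts H"
      using f by (auto simp: bij_betw_def)
    have sub: "parcs G \<subseteq> pverts G \<times> pverts G"
      using G.wellformed' by auto
    have "inj_on (map_prod f f) (parcs G)"
      using map_prod_inj_on[OF inj inj] sub inj_on_subset by blast
    then have iso: "pre_digraph.digraph_isomorphism (with_proj G) h"
      using inj G.wf_digraph
      by (auto simp: pre_digraph.digraph_isomorphism_def h_def)
    have "map_prod f f ` parcs G = parcs H"
    proof
      show "map_prod f f ` parcs G \<subseteq> parcs H"
        using adj sub by auto
      show "parcs H \<subseteq> map_prod f f ` parcs G"
      proof
        fix e assume e: "e \<in> parcs H"
        obtain u v where uv: "e = (u, v)" by (cases e)
        have "u \<in> f ` pverts G" "v \<in> f ` pverts G"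
          using H.wellformed' e uv V by auto
        then obtain x y where xy: "x \<in> pverts G" "y \<in> pverts G" "u = f x" "v = f y"
          by blast
        then have "(x, y) \<in> parcs G" using adj e uv by simp
        then show "e \<in> map_prod f f ` parcs G" using uv xy by force
      qed
    qed
    then have "with_proj H = app_iso h (with_proj G)"
      using V by (simp add: app_iso_def h_def with_proj_def)
    with iso show ?L unfolding digraph_iso_def by blast
  }
qed

end

theory Submission
  imports Defs
begin

text \<open>
  The vertices and the arcs of both graphs are described by linear structure, grading and bracket
  alone, so an isomorphism \<open>f\<close> of Lie superalgebras should itself be an isomorphism of the graphs.
  The two facts that carry this hold for every homomorphism of Lie superalgebras: it maps
  the subsuperalgebra generated by \<open>x\<close> and \<open>y\<close> onto the one generated by \<open>f x\<close> and \<open>f y\<close>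
  (\<open>image_generated\<close>), and it commutes with the derived series (\<open>image_derived_series\<close>).

  If \<open>f\<close> is injective, a term of the derived series vanishes exactly when its image does, so
  \<open>\<langle>x, y\<rangle>\<close> is solvable exactly when \<open>\<langle>f x, f y\<rangle>\<close> is. If \<open>f\<close> is also surjective, every
  element to be tested against \<open>f x\<close> in the definition of \<open>sol\<close> has the form \<open>f z\<close>, so \<open>f\<close> maps
  \<open>sol\<close> onto \<open>sol\<close> and hence vertices onto vertices. Adjacency is then preserved and reflected in both graphs.
\<close>

locale lie_superalgebra_hom =
  L1: lie_superalgebra s1 br1 gr1 + L2: lie_superalgebra s2 br2 gr2
  for s1 :: "'k::field \<Rightarrow> 'a::ab_group_add \<Rightarrow> 'a"
    and br1 :: "'a \<Rightarrow> 'a \<Rightarrow> 'a" and gr1 :: "bit \<Rightarrow> 'a set"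
    and s2 :: "'k \<Rightarrow> 'b::ab_group_add \<Rightarrow> 'b"
    and br2 :: "'b \<Rightarrow> 'b \<Rightarrow> 'b" and gr2 :: "bit \<Rightarrow> 'b set" +
  fixes f :: "'a \<Rightarrow> 'b"
  assumes linear: "Vector_Spaces.linear s1 s2 f"
    and image_gr: "f ` gr1 i \<subseteq> gr2 i"
    and image_bracket: "f (br1 x y) = br2 (f x) (f y)"
begin

sublocale f: Vector_Spaces.linear s1 s2 f
  by (rule linear)

lemma hom_gr: "x \<in> gr1 i \<Longrightarrow> f x \<in> gr2 i"
  using image_gr[of i] by blast

lemma subsuperalgebra_image:
  assumes S: "L1.subsuperalgebra S"
  shows "L2.subsuperalgebra (f ` S)"
  unfolding L2.subsuperalgebra_def
proof (intro conjI)
  show "L2.subspace (f ` S)"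
    using S by (simp add: L1.subsuperalgebra_def f.subspace_image)
  show "\<forall>x \<in> f ` S. \<exists>a \<in> f ` S \<inter> gr2 0. \<exists>b \<in> f ` S \<inter> gr2 1. x = a + b"
  proof
    fix y assume "y \<in> f ` S"
    then obtain x where "x \<in> S" and y: "y = f x" by blast
    then obtain a b where "a \<in> S \<inter> gr1 0" "b \<in> S \<inter> gr1 1" "x = a + b"
      using S unfolding L1.subsuperalgebra_def by metis
    then have "f a \<in> f ` S \<inter> gr2 0" "f b \<in> f ` S \<inter> gr2 1" "y = f a + f b"
      using hom_gr y by (auto simp: f.add)
    then show "\<exists>a \<in> f ` S \<inter> gr2 0. \<exists>b \<in> f ` S \<inter> gr2 1. y = a + b"
      by blast
  qed
  show "\<forall>x \<in> f ` S. \<forall>y \<in> f ` S. br2 x y \<in> f ` S"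
    using S by (auto simp: L1.subsuperalgebra_def image_bracket[symmetric])
qed

text \<open>
  Only the grading needs an argument: the homogeneous parts of \<open>x\<close> exist in the whole algebra, and
  they lie in the preimage because \<open>f\<close> sends them to the homogeneous parts of \<open>f x\<close>, which are
  unique and therefore belong to \<open>T\<close>.
\<close>

lemma subsuperalgebra_vimage:
  assumes T: "L2.subsuperalgebra T"
  shows "L1.subsuperalgebra (f -` T)"
  unfolding L1.subsuperalgebra_def
proof (intro conjI)
  show "L1.subspace (f -` T)"
    using T by (simp add: L2.subsuperalgebra_def f.subspace_vimage)
  show "\<forall>x \<in> f -` T. \<exists>a \<in> f -` T \<inter> gr1 0. \<exists>b \<in> f -` T \<inter> gr1 1. x = a + b"
  proof
    fix x assume "x \<in> f -` T"
    then obtain a' b' where T': "a' \<in> T \<inter> gr2 0" "b' \<in> T \<inter> gr2 1" "f x = a' + b'"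
      using T unfolding L2.subsuperalgebra_def by (metis vimageD)
    obtain a b where ab: "a \<in> gr1 0" "b \<in> gr1 1" "x = a + b"
      using L1.gr_sum by blast
    have "f a \<in> gr2 0" "f b \<in> gr2 1" and "f a + f b = a' + b'"
      using ab T'(3) hom_gr by (auto simp: f.add)
    then have "f a = a'" "f b = b'"
      using T' L2.gr_decomp_unique[of "f a" a' "f b" b'] by auto
    with T' ab show "\<exists>a \<in> f -` T \<inter> gr1 0. \<exists>b \<in> f -` T \<inter> gr1 1. x = a + b"
      by blast
  qed
  show "\<forall>x \<in> f -` T. \<forall>y \<in> f -` T. br1 x y \<in> f -` T"
    using T by (simp add: L2.subsuperalgebra_def image_bracket)
qed

text \<open>
  By minimality of the hull: the image of \<open>\<langle>x, y\<rangle>\<close> is a subsuperalgebra containing \<open>f x\<close> and \<open>f y\<close>,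
  and the preimage of \<open>\<langle>f x, f y\<rangle>\<close> is one containing \<open>x\<close> and \<open>y\<close>.
\<close>

lemma image_generated: "f ` L1.generated x y = L2.generated (f x) (f y)"
proof
  have "{f x, f y} \<subseteq> L2.generated (f x) (f y)"
    unfolding L2.generated_def by (rule hull_subset)
  then have "L1.generated x y \<subseteq> f -` L2.generated (f x) (f y)"
    using subsuperalgebra_vimage[OF L2.subsuperalgebra_generated]
    unfolding L1.generated_def by (intro hull_minimal) auto
  then show "f ` L1.generated x y \<subseteq> L2.generated (f x) (f y)"
    by blast
  have "{x, y} \<subseteq> L1.generated x y"
    unfolding L1.generated_def by (rule hull_subset)
  then show "L2.generated (f x) (f y) \<subseteq> f ` L1.generated x y"
    using subsuperalgebra_image[OF L1.subsuperalgebra_generated]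
    unfolding L2.generated_def by (intro hull_minimal) auto
qed

lemma image_derived_series: "f ` L1.derived_series S n = L2.derived_series (f ` S) n"
proof (induction n)
  case (Suc n)
  let ?D = "L1.derived_series S n"
  have "f ` {br1 x y | x y. x \<in> ?D \<and> y \<in> ?D} = {br2 x y | x y. x \<in> f ` ?D \<and> y \<in> f ` ?D}"
    (is "_ = ?R")
  proof
    show "f ` {br1 x y | x y. x \<in> ?D \<and> y \<in> ?D} \<subseteq> ?R"
      using image_bracket by blast
    show "?R \<subseteq> f ` {br1 x y | x y. x \<in> ?D \<and> y \<in> ?D}"
    proof
      fix z assume "z \<in> ?R"
      then obtain x y where "x \<in> ?D" "y \<in> ?D" "z = br2 (f x) (f y)"
        by blast
      moreover from this have "z = f (br1 x y)"
        by (simp add: image_bracket)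
      ultimately show "z \<in> f ` {br1 x y | x y. x \<in> ?D \<and> y \<in> ?D}"
        by blast
    qed
  qed
  then show ?case
    by (simp only: L1.derived_series.simps L2.derived_series.simps f.span_image[symmetric] Suc.IH)
qed simp

lemma solvable_image_iff:
  assumes "inj f"
  shows "L2.solvable (f ` S) \<longleftrightarrow> L1.solvable S"
proof -
  have "f ` D = {0} \<longleftrightarrow> D = {0}" for D
    using inj_image_eq_iff[OF assms, of D "{0}"] by (simp add: f.zero)
  then show ?thesis
    by (simp add: L1.solvable_def L2.solvable_def image_derived_series[symmetric])
qed

lemma solvable_generated_iff:
  assumes "inj f"
  shows "L2.solvable (L2.generated (f x) (f y)) \<longleftrightarrow> L1.solvable (L1.generated x y)"
  using solvable_image_iff[OF assms] by (simp add: image_generated[symmetric])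

lemma sol_iff:
  assumes "bij f"
  shows "f x \<in> L2.sol \<longleftrightarrow> x \<in> L1.sol"
proof -
  have "f x \<in> L2.sol \<longleftrightarrow> (\<forall>w \<in> range f. L2.solvable (L2.generated w (f x)))"
    by (simp add: L2.sol_def bij_is_surj[OF assms])
  also have "\<dots> \<longleftrightarrow> (\<forall>z. L2.solvable (L2.generated (f z) (f x)))"
    by blast
  also have "\<dots> \<longleftrightarrow> x \<in> L1.sol"
    by (simp add: solvable_generated_iff[OF bij_is_inj[OF assms]] L1.sol_def)
  finally show ?thesis .
qed

lemma graph_vertices_iff:
  assumes "bij f"
  shows "f x \<in> L2.graph_vertices \<longleftrightarrow> x \<in> L1.graph_vertices"
proof -
  have "f x = 0 \<longleftrightarrow> x = 0"
    using inj_eq[OF bij_is_inj[OF assms], of x 0] by (simp add: f.zero)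
  then show ?thesis
    by (simp add: L1.graph_vertices_def L2.graph_vertices_def sol_iff[OF assms])
qed

lemma bij_betw_graph_vertices:
  assumes "bij f"
  shows "bij_betw f L1.graph_vertices L2.graph_vertices"
proof (rule bij_betw_imageI)
  show "inj_on f L1.graph_vertices"
    using bij_is_inj[OF assms] by (rule inj_on_subset) simp
  show "f ` L1.graph_vertices = L2.graph_vertices"
  proof
    show "f ` L1.graph_vertices \<subseteq> L2.graph_vertices"
      by (auto simp: graph_vertices_iff[OF assms])
    show "L2.graph_vertices \<subseteq> f ` L1.graph_vertices"
    proof
      fix y assume "y \<in> L2.graph_vertices"
      moreover obtain x where "y = f x"
        using surjD[OF bij_is_surj[OF assms]] by blast
      ultimately show "y \<in> f ` L1.graph_vertices"
        by (simp add: graph_vertices_iff[OF assms])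
    qed
  qed
qed

lemma solvable_graph_iso:
  assumes "bij f"
  shows "digraph_iso (with_proj L1.solvable_graph) (with_proj L2.solvable_graph)"
proof -
  interpret G1: pair_bidirected_digraph L1.solvable_graph by (rule L1.simple_solvable_graph)
  interpret G2: pair_bidirected_digraph L2.solvable_graph by (rule L2.simple_solvable_graph)
  have "\<forall>x \<in> pverts L1.solvable_graph. \<forall>y \<in> pverts L1.solvable_graph.
      (x, y) \<in> parcs L1.solvable_graph \<longleftrightarrow> (f x, f y) \<in> parcs L2.solvable_graph"
    using bij_is_inj[OF assms]
    by (simp add: L1.solvable_graph_def L2.solvable_graph_def graph_vertices_iff[OF assms]
        solvable_generated_iff inj_eq)
  moreover have "bij_betw f (pverts L1.solvable_graph) (pverts L2.solvable_graph)"
    using bij_betw_graph_vertices[OF assms]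
    by (simp add: L1.solvable_graph_def L2.solvable_graph_def)
  ultimately show ?thesis
    unfolding digraph_iso_pair_iff[OF G1.pair_wf_digraph_axioms G2.pair_wf_digraph_axioms]
    by blast
qed

lemma nonsolvable_graph_iso:
  assumes "bij f"
  shows "digraph_iso (with_proj L1.nonsolvable_graph) (with_proj L2.nonsolvable_graph)"
proof -
  interpret G1: pair_bidirected_digraph L1.nonsolvable_graph by (rule L1.simple_nonsolvable_graph)
  interpret G2: pair_bidirected_digraph L2.nonsolvable_graph by (rule L2.simple_nonsolvable_graph)
  have "\<forall>x \<in> pverts L1.nonsolvable_graph. \<forall>y \<in> pverts L1.nonsolvable_graph.
      (x, y) \<in> parcs L1.nonsolvable_graph \<longleftrightarrow> (f x, f y) \<in> parcs L2.nonsolvable_graph"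
    using bij_is_inj[OF assms]
    by (simp add: L1.nonsolvable_graph_def L2.nonsolvable_graph_def graph_vertices_iff[OF assms]
        solvable_generated_iff inj_eq)
  moreover have "bij_betw f (pverts L1.nonsolvable_graph) (pverts L2.nonsolvable_graph)"
    using bij_betw_graph_vertices[OF assms]
    by (simp add: L1.nonsolvable_graph_def L2.nonsolvable_graph_def)
  ultimately show ?thesis
    unfolding digraph_iso_pair_iff[OF G1.pair_wf_digraph_axioms G2.pair_wf_digraph_axioms]
    by blast
qed

end

theorem proposition15:
  fixes s1 :: "'k::field \<Rightarrow> 'a::ab_group_add \<Rightarrow> 'a"
    and br1 :: "'a \<Rightarrow> 'a \<Rightarrow> 'a" and gr1 :: "bit \<Rightarrow> 'a set"
    and s2 :: "'k \<Rightarrow> 'b::ab_group_add \<Rightarrow> 'b"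
    and br2 :: "'b \<Rightarrow> 'b \<Rightarrow> 'b" and gr2 :: "bit \<Rightarrow> 'b set"
  assumes "lie_superalgebra s1 br1 gr1" and "lie_superalgebra s2 br2 gr2"
    and "\<exists>B. finite_dimensional_vector_space s1 B"
    and "\<exists>B. finite_dimensional_vector_space s2 B"
    and "\<not> lie_superalgebra.solvable s1 br1 UNIV"
    and "\<not> lie_superalgebra.solvable s2 br2 UNIV"
    and "lie_superalgebra_isomorphic s1 br1 gr1 s2 br2 gr2"
  shows "digraph_iso (with_proj (lie_superalgebra.solvable_graph s1 br1 gr1))
           (with_proj (lie_superalgebra.solvable_graph s2 br2 gr2)) \<and>
         digraph_iso (with_proj (lie_superalgebra.nonsolvable_graph s1 br1 gr1))
           (with_proj (lie_superalgebra.nonsolvable_graph s2 br2 gr2))"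
proof -
  obtain f where f: "Vector_Spaces.linear s1 s2 f" "bij f"
    "\<And>i. f ` gr1 i \<subseteq> gr2 i" "\<And>x y. f (br1 x y) = br2 (f x) (f y)"
    using assms(7) unfolding lie_superalgebra_isomorphic_def by blast
  interpret lie_superalgebra_hom s1 br1 gr1 s2 br2 gr2 f
    using assms(1,2) f by (simp add: lie_superalgebra_hom_def lie_superalgebra_hom_axioms_def)
  show ?thesis
    using solvable_graph_iso[OF f(2)] nonsolvable_graph_iso[OF f(2)] by blast
qed

end
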